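(* Let $p\geq q\geq 2$ be integers, and let $\mathcal{L}$ denote the equation $px+qy=z$. Suppose that $n>2p$. Then $f_{\max}(n,\mathcal{L})\geq 2^{\ell}$, where $\ell$ is defined as follows: (i) $\ell:=(n(q-1)-pq+q-2q^2)/q^2$ if $p\geq q^2$; (ii) $\ell:=(n(p-q)-p^2+q^2-2pq)/(pq)$ if $q<p<q^2$; (iii) $\ell:=(n-6q)/(2q)$ if $p=q$.
   Context: $[n]=\{1,\dots,n\}$. A set $A\subseteq[n]$ is $\mathcal{L}$-free, for $\mathcal{L}$ the equation $px+qy=z$ with $p,q$ as in the statement, if there are no $x,y,z\in A$ (not necessarily distinct) with $px+qy=z$ (such an equation has no trivial solutions). A set $S\subseteq[n]$ is a maximal $\mathcal{L}$-free subset of $[n]$ if it is $\mathcal{L}$-free and not properly contained in another $\mathcal{L}$-free subset of $[n]$; $f_{\max}(n,\mathcal{L})$ is the number of these. $\ell$ is a real number, not necessarily an integer. *)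

theory Defs
  imports Complex_Main
begin

text \<open>Solutions need not have distinct entries: \<open>x\<close>, \<open>y\<close>, \<open>z\<close> range over \<open>A\<close> independently.\<close>

definition sol_free :: "nat \<Rightarrow> nat \<Rightarrow> nat set \<Rightarrow> bool" where
  "sol_free p q A \<longleftrightarrow> \<not> (\<exists>x\<in>A. \<exists>y\<in>A. \<exists>z\<in>A. p * x + q * y = z)"

definition maximal_sol_free :: "nat \<Rightarrow> nat \<Rightarrow> nat \<Rightarrow> nat set \<Rightarrow> bool" where
  "maximal_sol_free p q n S \<longleftrightarrow>
     S \<subseteq> {1..n} \<and> sol_free p q S \<and> \<not> (\<exists>T. T \<subseteq> {1..n} \<and> sol_free p q T \<and> S \<subset> T)"

definition f_max :: "nat \<Rightarrow> nat \<Rightarrow> nat \<Rightarrow> nat" where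
  "f_max n p q = card {S. maximal_sol_free p q n S}"

end

theory Submission
  imports Defs
begin

text \<open>
  With \<open>x = 1\<close> the equation becomes \<open>z = q y + p\<close>. Take an interval \<open>Y\<close> of values \<open>y\<close>, high enough
  that \<open>1\<close> together with one element chosen from each of the disjoint pairs \<open>{y, q y + p}\<close>
  is always solution-free. A solution-free set containing \<open>1\<close> never contains such a pair entirely,
  so distinct choices extend to distinct maximal solution-free sets, and there are at least
  \<open>2 ^ card Y\<close> of them. The interval is \<open>(n - q) / min p (q\<^sup>2) < y \<le> (n - p) / q\<close> if \<open>p > q\<close>, and
  \<open>n / (2 q) < y \<le> n / q - 1\<close> if \<open>p = q\<close>, in both cases without the pair that contains the
  value \<open>p + q\<close> forbidden by \<open>x = y = 1\<close>.
\<close>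

section \<open>Counting maximal sets through extensions of choices\<close>

lemma maximal_sol_free_extension:
  assumes "S \<subseteq> {1..n}" and "sol_free p q S"
  obtains M where "maximal_sol_free p q n M" and "S \<subseteq> M"
proof -
  let ?F = "{T. T \<subseteq> {1..n} \<and> sol_free p q T}"
  have "finite ?F" by (rule finite_subset[of _ "Pow {1..n}"]) auto
  from finite_has_maximal2[OF this, of S] assms
  obtain M where "M \<in> ?F" "S \<subseteq> M" and max: "\<forall>T\<in>?F. M \<subseteq> T \<longrightarrow> M = T" by auto
  then have "maximal_sol_free p q n M"
    unfolding maximal_sol_free_def by blast
  with \<open>S \<subseteq> M\<close> show ?thesis by (rule that[rotated])
qed

lemma finite_maximal_sol_free: "finite {S. maximal_sol_free p q n S}"
  by (rule finite_subset[of _ "Pow {1..n}"]) (auto simp: maximal_sol_free_def)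

text \<open>Any maximal extension \<open>M T\<close> of the set chosen by \<open>T\<close>
  determines \<open>T\<close> as the intersection of \<open>M T\<close> with \<open>Y\<close>: for
  \<open>y\<close> in \<open>Y - T\<close> it contains \<open>1\<close> and
  \<open>q * y + p\<close>, so it cannot contain \<open>y\<close>.\<close>

lemma f_max_ge_power_card:
  assumes fin: "finite Y"
    and range: "\<And>y. y \<in> Y \<Longrightarrow> 1 \<le> y \<and> q * y + p \<le> n"
    and "n \<ge> 1" and "q \<ge> 1"
    and free: "\<And>T. T \<subseteq> Y \<Longrightarrow> sol_free p q (insert 1 (T \<union> (\<lambda>y. q * y + p) ` (Y - T)))"
  shows "2 ^ card Y \<le> f_max n p q"
proof -
  define C where "C T = insert 1 (T \<union> (\<lambda>y. q * y + p) ` (Y - T))" for T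
  have "\<exists>M. maximal_sol_free p q n M \<and> C T \<subseteq> M" if T: "T \<subseteq> Y" for T
  proof -
    have "y \<le> n" if "y \<in> Y" for y
    proof -
      have "y \<le> q * y" using \<open>q \<ge> 1\<close> by simp
      then show ?thesis using range[OF that] by linarith
    qed
    then have "C T \<subseteq> {1..n}"
      using T range \<open>n \<ge> 1\<close> \<open>q \<ge> 1\<close> unfolding C_def
      by (auto simp: Suc_le_eq)
    then show ?thesis
      using free[OF T] maximal_sol_free_extension unfolding C_def by metis
  qed
  then obtain M where M: "\<And>T. T \<subseteq> Y \<Longrightarrow> maximal_sol_free p q n (M T) \<and> C T \<subseteq> M T"
    by metis
  have sub: "T \<subseteq> T'" if "T \<subseteq> Y" "T' \<subseteq> Y" "M T = M T'" for T T'
  proof (rule subsetI, rule ccontr)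
    fix t assume t: "t \<in> T" "t \<notin> T'"
    have "1 \<in> M T" "t \<in> M T" using M[OF that(1)] t by (auto simp: C_def)
    \<comment> \<open>\<open>T'\<close> omits \<open>t\<close> and so contributes its partner, while
      \<open>M T'\<close> is the same set as \<open>M T\<close>.\<close>
    moreover have "q * t + p \<in> M T" using M[OF that(2)] t that unfolding C_def by blast
    moreover have "sol_free p q (M T)" using M[OF that(1)] by (simp add: maximal_sol_free_def)
    ultimately show False by (auto simp: sol_free_def add.commute)
  qed
  have "inj_on M (Pow Y)"
    by (rule inj_onI) (use sub in \<open>simp add: subset_antisym\<close>)
  moreover have "M ` Pow Y \<subseteq> {S. maximal_sol_free p q n S}" using M by auto
  ultimately have "card (Pow Y) \<le> f_max n p q"
    unfolding f_max_def by (rule card_inj_on_le[OF _ _ finite_maximal_sol_free])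
  then show ?thesis by (simp add: card_Pow fin)
qed

section \<open>Solution-freeness of the choices\<close>

text \<open>Two elements of \<open>U\<close> give a value above \<open>n\<close> by
  \<open>high\<close>, so a solution would have \<open>x = 1\<close> or \<open>y = 1\<close>. The
  case \<open>y = 1\<close> is handled by \<open>high_x\<close> or by symmetry, and
  \<open>x = y = 1\<close> by \<open>sum\<close>. For \<open>x = 1\<close>, a chosen lower element
  lacks its partner, and an upper element gives a value above \<open>n\<close> by
  \<open>high_z\<close>.\<close>

lemma sol_free_choice:
  assumes "p \<ge> 1" and "q \<ge> 1" and T: "T \<subseteq> Y"
    and U: "U = Y \<union> (\<lambda>y. q * y + p) ` Y"
    and pos: "\<And>x. x \<in> U \<Longrightarrow> 1 \<le> x \<and> x \<le> n"
    and disjoint: "\<And>x y. x \<in> Y \<Longrightarrow> y \<in> Y \<Longrightarrow> x \<noteq> q * y + p"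
    and high: "\<And>x y. x \<in> U \<Longrightarrow> y \<in> U \<Longrightarrow> n < p * x + q * y"
    and high_x: "\<And>x. x \<in> U \<Longrightarrow> n < p * x + q \<or> p = q"
    and high_z: "\<And>y. y \<in> Y \<Longrightarrow> n < q * (q * y + p) + p"
    and sum: "p + q \<notin> U"
  shows "sol_free p q (insert 1 (T \<union> (\<lambda>y. q * y + p) ` (Y - T)))"
proof -
  define V where "V = T \<union> (\<lambda>y. q * y + p) ` (Y - T)"
  have VU: "V \<subseteq> U" using T by (auto simp: V_def U)
  have small: "z \<le> n" if "z \<in> V" for z using pos VU that by blast
  have y_fixed: "p + q * y \<notin> V" if "y \<in> V" for y
  proof
    assume z: "p + q * y \<in> V"
    consider "y \<in> T" | y' where "y' \<in> Y" "y = q * y' + p" using \<open>y \<in> V\<close> by (auto simp: V_def)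
    then show False
    proof cases
      case 1
      \<comment> \<open>A member of \<open>T\<close> cannot equal \<open>p + q * y\<close> by
        \<open>disjoint\<close>. If it is the partner of some element of \<open>Y - T\<close>,
        cancelling \<open>q\<close> identifies that element with \<open>y\<close>, which lies in
        \<open>T\<close>.\<close>
      with z disjoint[of "p + q * y" y] T \<open>q \<ge> 1\<close> show False
        by (auto simp: V_def add.commute)
    next
      case 2
      with high_z[of y'] small[OF z] show False by simp
    qed
  qed
  have x_fixed: "p * x + q \<notin> V" if "x \<in> V" for x
    \<comment> \<open>If \<open>p = q\<close>, then \<open>p * x + q\<close> is the value already
      excluded by \<open>y_fixed\<close>.\<close>
    using high_x[of x] small[of "p * x + q"] y_fixed[of x] VU that by (auto simp: add.commute)
  have "p * x + q * y \<notin> V" if "x \<in> V" "y \<in> V" for x y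
    using high[of x y] small[of "p * x + q * y"] subsetD[OF VU] that by force
  moreover have "p * x + q * y \<noteq> 1" if "x \<in> insert 1 V" "y \<in> insert 1 V" for x y
  proof -
    have "1 \<le> x" "1 \<le> y" using that pos VU by auto
    then have "1 \<le> p * x" "1 \<le> q * y" using assms(1,2) by simp_all
    then show ?thesis by linarith
  qed
  moreover have "p + q \<notin> V" using sum VU by auto
  ultimately have "p * x + q * y \<notin> insert 1 V" if "x \<in> insert 1 V" "y \<in> insert 1 V" for x y
    using that x_fixed[of x] y_fixed[of y] by auto
  then show ?thesis unfolding sol_free_def V_def by blast
qed

text \<open>Removing \<open>1\<close> and \<open>p + q\<close> discards the pair that contains \<open>p + q\<close>; \<open>not_both\<close> makes this cost
  at most one pair.\<close>

lemma f_max_ge_interval: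
  fixes a b :: nat
  assumes "p \<ge> 1" and "q \<ge> 1" and "n \<ge> 1"
    and Z: "Z = {a<..b} \<union> (\<lambda>y. q * y + p) ` {a<..b}"
    and upper: "q * b + p \<le> n"
    and disjoint: "\<And>y. y \<in> {a<..b} \<Longrightarrow> b < q * y + p"
    and high: "\<And>x y. x \<in> Z \<Longrightarrow> y \<in> Z \<Longrightarrow> n < p * x + q * y"
    and high_x: "\<And>x. x \<in> Z \<Longrightarrow> n < p * x + q \<or> p = q"
    and high_z: "\<And>y. y \<in> {a<..b} \<Longrightarrow> n < q * (q * y + p) + p"
    and not_both: "\<not> (1 \<in> {a<..b} \<and> p + q \<in> {a<..b})"
  shows "2 powr (real b - real a - 1) \<le> real (f_max n p q)"
proof -
  define Y where "Y = {a<..b} - {1, p + q}"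
  have upper': "q * y + p \<le> n" if "y \<le> b" for y
    using upper mult_le_mono2[OF that, of q] by linarith
  have le: "y \<le> n" if "y \<le> b" for y
  proof -
    have "y \<le> q * y" using \<open>q \<ge> 1\<close> by simp
    then show ?thesis using upper'[OF that] by linarith
  qed
  define U where "U = Y \<union> (\<lambda>y. q * y + p) ` Y"
  have UZ: "U \<subseteq> Z" unfolding U_def Y_def Z by auto
  have "2 ^ card Y \<le> f_max n p q"
  proof (rule f_max_ge_power_card)
    fix T assume "T \<subseteq> Y"
    then show "sol_free p q (insert 1 (T \<union> (\<lambda>y. q * y + p) ` (Y - T)))"
    proof (rule sol_free_choice[OF \<open>p \<ge> 1\<close> \<open>q \<ge> 1\<close> _ U_def, where n = n])
      show "1 \<le> x \<and> x \<le> n" if "x \<in> U" for x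
        using that upper' le \<open>p \<ge> 1\<close> by (auto simp: U_def Y_def)
      show "x \<noteq> q * y + p" if "x \<in> Y" "y \<in> Y" for x y
        using that disjoint[of y] by (auto simp: Y_def)
      show "p + q \<notin> U" using \<open>q \<ge> 1\<close> by (auto simp: U_def Y_def)
      show "n < q * (q * y + p) + p" if "y \<in> Y" for y using high_z[of y] that by (simp add: Y_def)
    qed (use high high_x UZ in blast)+
  qed (use upper' assms(2,3) in \<open>auto simp: Y_def\<close>)
  moreover have "real b - real a - 1 \<le> real (card Y)"
  proof -
    \<comment> \<open>By \<open>not_both\<close> at most one point is removed, which is the
      \<open>- 1\<close> in the exponent.\<close>
    have "card ({a<..b} \<inter> {1, p + q}) \<le> card {if 1 \<in> {a<..b} then 1 else p + q}"
      by (rule card_mono) (use not_both in auto)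
    moreover have "card Y = card {a<..b} - card ({a<..b} \<inter> {1, p + q})"
      unfolding Y_def by (rule card_Diff_subset_Int) simp
    ultimately show ?thesis by simp
  qed
  then have "2 powr (real b - real a - 1) \<le> 2 powr real (card Y)"
    by (intro powr_mono) auto
  ultimately show ?thesis
    by (simp add: powr_realpow) (metis (mono_tags, lifting) of_nat_le_iff of_nat_numeral of_nat_power order_trans)
qed

section \<open>Choosing the interval\<close>

text \<open>The bound \<open>m \<le> p\<close> makes \<open>p * x + q\<close> exceed
  \<open>n\<close> above \<open>a\<close>, and \<open>m \<le> q\<^sup>2\<close> does the same for
  the values \<open>q * (q * y + p) + p\<close>. A larger \<open>m\<close> lowers \<open>a\<close>
  and improves the bound. The \<open>- 2\<close> pays for rounding \<open>b\<close> down and for the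
  discarded pair.\<close>

lemma f_max_ge_distinct_coeffs:
  fixes p q n m :: nat
  assumes "q \<le> p" and "2 \<le> q" and "n > 2 * p" and "m \<ge> 1" and "m \<le> p" and "m \<le> q\<^sup>2"
  shows "2 powr ((real n - real p) / real q - (real n - real q) / real m - 2) \<le> real (f_max n p q)"
proof -
  define a where "a = (n - q) div m"
  define b where "b = (n - p) div q"
  have a: "n < m * y + q" if "a < y" for y
  proof -
    have "n - q < y * m" using that \<open>m \<ge> 1\<close> by (simp add: a_def div_less_iff_less_mult)
    then show ?thesis by (simp add: mult.commute)
  qed
  have b: "q * b + p \<le> n"
  proof -
    have "q * b \<le> n - p" by (simp add: b_def)
    then show ?thesis using \<open>n > 2 * p\<close> by linarith
  qed
  have py: "n < p * y + q" if "a < y" for y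
    using a[OF that] mult_le_mono1[OF \<open>m \<le> p\<close>, of y] by linarith
  have qy: "n < q * (q * y) + q" if "a < y" for y
    using a[OF that] mult_le_mono1[OF \<open>m \<le> q\<^sup>2\<close>, of y]
    unfolding power2_eq_square mult.assoc by linarith
  have low: "a < x" if "x \<in> {a<..b} \<union> (\<lambda>y. q * y + p) ` {a<..b}" for x
  proof -
    have "y \<le> q * y + p" for y :: nat using \<open>2 \<le> q\<close> by (simp add: trans_le_add1)
    then show ?thesis using that by (force intro: less_le_trans)
  qed
  have "2 powr (real b - real a - 1) \<le> real (f_max n p q)"
  proof (rule f_max_ge_interval[OF _ _ _ refl b])
    fix y assume y: "y \<in> {a<..b}"
    show "n < q * (q * y + p) + p"
      using qy[of y] y \<open>q \<le> p\<close> by (simp add: distrib_left)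
    show "b < q * y + p"
    proof (rule ccontr)
      assume "\<not> b < q * y + p"
      \<comment> \<open>Adding \<open>p\<close> to both sides bounds
        \<open>q * (q * y) + q * p + p\<close> by \<open>n\<close>, against
        \<open>qy\<close>.\<close>
      then have "q * (q * y + p) \<le> q * b" by simp
      moreover have "q \<le> q * p" using assms by simp
      ultimately show False using b qy[of y] y \<open>q \<le> p\<close> by (simp add: distrib_left)
    qed
  next
    fix x assume "x \<in> {a<..b} \<union> (\<lambda>y. q * y + p) ` {a<..b}"
    then have x: "n < p * x + q" by (rule py[OF low])
    then show "n < p * x + q \<or> p = q" ..
    fix y assume "y \<in> {a<..b} \<union> (\<lambda>y. q * y + p) ` {a<..b}"
    then have "1 \<le> y" using low by fastforce
    then have "q \<le> q * y" by simp
    with x show "n < p * x + q * y" by linarith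
  next
    show "\<not> (1 \<in> {a<..b} \<and> p + q \<in> {a<..b})"
      \<comment> \<open>If \<open>1\<close> were in the interval, then
        \<open>n < p + q \<le> 2 * p\<close>.\<close>
      using py[of 1] assms by auto
  qed (use assms in auto)
  moreover have "real a \<le> (real n - real q) / real m"
    using of_nat_div_le_of_nat[of "n - q" m, where ?'a = real] assms
    by (simp add: a_def of_nat_diff)
  moreover have "(real n - real p) / real q - 1 \<le> real b"
  proof -
    have "n - p < (b + 1) * q" unfolding b_def using \<open>2 \<le> q\<close>
      by (metis Suc_eq_plus1 div_less_iff_less_mult lessI less_le_trans pos2)
    then have "real n - real p < (real b + 1) * real q"
      using assms by (smt (verit) of_nat_1 of_nat_add of_nat_less_iff of_nat_mult of_nat_diff le_add2 mult_2 order.strict_implies_order order_trans)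
    then show ?thesis using assms by (simp add: field_simps)
  qed
  ultimately show ?thesis
    by (smt (verit) powr_mono)
qed

text \<open>By symmetry only sums of two large elements have to be pushed beyond \<open>n\<close>,
  and each summand may supply half. The interval can thus start at \<open>n / (2 * q)\<close>, about
  half as high as the bound with \<open>m = p\<close> would allow.\<close>

lemma f_max_ge_equal_coeffs:
  fixes q n :: nat
  assumes "2 \<le> q" and "n > 2 * q"
  shows "2 powr ((real n - 6 * real q) / (2 * real q)) \<le> real (f_max n q q)"
proof -
  define a where "a = n div (2 * q)"
  define b where "b = (n - q) div q"
  have a: "n < 2 * (q * y)" if "a < y" for y
  proof -
    have "n < y * (2 * q)" using that \<open>2 \<le> q\<close> by (simp add: a_def div_less_iff_less_mult)
    then show ?thesis by (simp add: mult_ac)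
  qed
  have b: "q * b + q \<le> n"
  proof -
    have "q * b \<le> n - q" by (simp add: b_def)
    then show ?thesis using \<open>n > 2 * q\<close> by linarith
  qed
  have low: "a < x" if "x \<in> {a<..b} \<union> (\<lambda>y. q * y + q) ` {a<..b}" for x
  proof -
    have "y \<le> q * y + q" for y :: nat using \<open>2 \<le> q\<close> by (simp add: trans_le_add1)
    then show ?thesis using that by (force intro: less_le_trans)
  qed
  have bound: "2 powr (real b - real a - 1) \<le> real (f_max n q q)"
  proof (rule f_max_ge_interval[OF _ _ _ refl b])
    fix y assume y: "y \<in> {a<..b}"
    have "2 * (q * y) \<le> q * (q * y)" using \<open>2 \<le> q\<close> by (rule mult_le_mono1)
    then show z: "n < q * (q * y + q) + q" using a[of y] y
      unfolding distrib_left greaterThanAtMost_iff by linarith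
    \<comment> \<open>Hence \<open>2 * b \<le> n - q < 2 * (q * y)\<close>, so no upper element
      falls back into the interval.\<close>
    have "2 * b \<le> q * b" using \<open>2 \<le> q\<close> by (rule mult_le_mono1)
    then show "b < q * y + q" using a[of y] y b
      unfolding greaterThanAtMost_iff by linarith
  next
    fix x y assume "x \<in> {a<..b} \<union> (\<lambda>y. q * y + q) ` {a<..b}" "y \<in> {a<..b} \<union> (\<lambda>y. q * y + q) ` {a<..b}"
    then show "n < q * x + q * y" using a[OF low, of x] a[OF low, of y] by linarith
  next
    show "\<not> (1 \<in> {a<..b} \<and> q + q \<in> {a<..b})"
      using a[of 1] assms by auto
  qed (use assms in auto)
  have "real a \<le> real n / (2 * real q)"
    using of_nat_div_le_of_nat[of n "2 * q", where ?'a = real] by (simp add: a_def)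
  moreover have "real n / real q - 2 \<le> real b"
  proof -
    have "n - q < (b + 1) * q" unfolding b_def using \<open>2 \<le> q\<close>
      by (metis Suc_eq_plus1 div_less_iff_less_mult lessI less_le_trans pos2)
    then have "n < (b + 2) * q" by (simp add: algebra_simps)
    then have "real n < (real b + 2) * real q"
      by (metis of_nat_add of_nat_less_iff of_nat_mult of_nat_numeral)
    then show ?thesis using assms by (simp add: field_simps)
  qed
  \<comment> \<open>The \<open>3\<close> combines the loss of \<open>2\<close> in the bound for
    \<open>b\<close> with the one discarded pair.\<close>
  moreover have "(real n - 6 * real q) / (2 * real q) = real n / real q - real n / (2 * real q) - 3"
    using assms by (simp add: field_simps)
  ultimately have "(real n - 6 * real q) / (2 * real q) \<le> real b - real a - 1"
    by argo
  then have "2 powr ((real n - 6 * real q) / (2 * real q)) \<le> 2 powr (real b - real a - 1)"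
    by (intro powr_mono) auto
  with bound show ?thesis by (rule order_trans[rotated])
qed

theorem proposition24:
  fixes p q n :: nat
  assumes "p \<ge> q" and "q \<ge> 2" and "n > 2 * p"
  shows "(p \<ge> q\<^sup>2 \<longrightarrow>
            real (f_max n p q) \<ge>
              2 powr ((real n * (real q - 1) - real p * real q + real q - 2 * (real q)\<^sup>2) / (real q)\<^sup>2))
       \<and> (q < p \<and> p < q\<^sup>2 \<longrightarrow>
            real (f_max n p q) \<ge>
              2 powr ((real n * (real p - real q) - (real p)\<^sup>2 + (real q)\<^sup>2 - 2 * real p * real q)
                       / (real p * real q)))
       \<and> (p = q \<longrightarrow>
            real (f_max n p q) \<ge> 2 powr ((real n - 6 * real q) / (2 * real q)))"
proof (intro conjI impI)
  have q: "real q > 0" and p: "real p > 0" using assms by auto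
  show "real (f_max n p q) \<ge>
      2 powr ((real n * (real q - 1) - real p * real q + real q - 2 * (real q)\<^sup>2) / (real q)\<^sup>2)"
    if "p \<ge> q\<^sup>2"
  proof -
    \<comment> \<open>Here \<open>m = q\<^sup>2\<close> is the largest value allowed by both
      \<open>m \<le> p\<close> and \<open>m \<le> q\<^sup>2\<close>; in the next case it is
      \<open>m = p\<close>.\<close>
    have "(real n * (real q - 1) - real p * real q + real q - 2 * (real q)\<^sup>2) / (real q)\<^sup>2
        = (real n - real p) / real q - (real n - real q) / real (q\<^sup>2) - 2"
      using q by (simp add: field_simps power2_eq_square)
    then show ?thesis using f_max_ge_distinct_coeffs[of q p n "q\<^sup>2"] assms that by simp
  qed
  show "real (f_max n p q) \<ge>
      2 powr ((real n * (real p - real q) - (real p)\<^sup>2 + (real q)\<^sup>2 - 2 * real p * real q)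
        / (real p * real q))"
    if "q < p \<and> p < q\<^sup>2"
  proof -
    have "(real n * (real p - real q) - (real p)\<^sup>2 + (real q)\<^sup>2 - 2 * real p * real q) / (real p * real q)
        = (real n - real p) / real q - (real n - real q) / real p - 2"
      using p q by (simp add: field_simps power2_eq_square)
    then show ?thesis using f_max_ge_distinct_coeffs[of q p n p] assms that by simp
  qed
  show "real (f_max n p q) \<ge> 2 powr ((real n - 6 * real q) / (2 * real q))" if "p = q"
    using f_max_ge_equal_coeffs[of q n] assms that by simp
qed

end
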